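(* Let $q\ge2$ be an integer and consider the implicit Runge-Kutta method with real coefficients $\hat\alpha_1,\dots,\hat\alpha_q$, $\hat\beta_1,\dots,\hat\beta_{q-1}$, $\hat d_1,\dots,\hat d_{q-1}$ described in the context, with stability function $\hat R(z)=\hat P(z)/\hat Q(z)$, where $\hat Q(z)=\prod_{j=1}^{q-1}(1-z\hat d_j)$ and $\hat P(z)=1+\sum_{j=1}^q\hat\sigma_jz^j$. Let $k\in\{1,\dots,q\}$ be such that $\hat\sigma_j=0$ for $j=k,\dots,q$. Then $\hat R(z)\to0$ as $|z|\to\infty$ if and only if the implicit method has at least $k$ nontrivial implicit stages.
   Context: The implicit method. For an integer $q\ge2$ and real coefficients $\hat\alpha_1,\dots,\hat\alpha_q$, $\hat\beta_1,\dots,\hat\beta_{q-1}$, $\hat d_1,\dots,\hat d_{q-1}$, the implicit method is the $(q+1)$-stage Runge-Kutta method with Butcher matrix $\hat A\in\mathbb R^{(q+1)\times(q+1)}$ (rows and columns indexed $1,\dots,q+1$) given by $\hat A_{j+1,j}=\hat\alpha_j$ for $1\le j\le q$, $\hat A_{j+1,1}=\hat\beta_{j-1}$ for $2\le j\le q$, $\hat A_{j+1,j+1}=\hat d_j$ for $1\le j\le q-1$, and all other entries zero; its weights are $\hat b_j=\hat A_{q+1,j}$ for $1\le j\le q+1$, and $\hat c=\hat A\mathbf 1$ with $\mathbf 1=(1,\dots,1)^T$. Stability function. $\hat R(z)=1+z\,\hat b^T(I-z\hat A)^{-1}\mathbf 1$. It is written as $\hat R(z)=\hat P(z)/\hat Q(z)$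 with $\hat Q(z)=\prod_{j=1}^{q-1}(1-z\hat d_j)$; then $\hat P=\hat R\hat Q$ is a polynomial of degree at most $q$ with $\hat P(0)=1$, and the real numbers $\hat\sigma_1,\dots,\hat\sigma_q$ are its coefficients: $\hat P(z)=1+\sum_{j=1}^q\hat\sigma_jz^j$. Implicit stages. The number of (nontrivial) implicit stages is the number of nonzero diagonal entries of $\hat A$, i.e. the number of $j\in\{1,\dots,q-1\}$ with $\hat d_j\ne0$.
   Formalization: The equivalence is proved for the smallest such k (σ̂_{k-1} ≠ 0 if k ≥ 2); for every other such k only "at least k implicit stages implies R̂ → 0" is stated, since the converse fails, e.g. q=2, α̂=(1,1/2), β̂_1=1/2, d̂_1=1, k=2. *)

theory Defs
  imports Complex_Main "Jordan_Normal_Form.Char_Poly"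
begin

(* Matrix and vector indices start at 0, so entry (i, j) below is the Butcher coefficient
   A_{i+1,j+1} of the usual 1-based numbering. The coefficient families keep their 1-based
   indices: only alpha 1..q, beta 1..(q-1) and d 1..(q-1) are used. *)
definition butcher_matrix ::
    "nat \<Rightarrow> (nat \<Rightarrow> real) \<Rightarrow> (nat \<Rightarrow> real) \<Rightarrow> (nat \<Rightarrow> real) \<Rightarrow> real mat" where
  "butcher_matrix q \<alpha> \<beta> d = mat (q + 1) (q + 1) (\<lambda>(i, j).
     if i = j + 1 then \<alpha> i
     else if j = 0 \<and> 2 \<le> i then \<beta> (i - 1)
     else if i = j \<and> 1 \<le> i \<and> i \<le> q - 1 then d i
     else 0)"

definition weights :: "nat \<Rightarrow> (nat \<Rightarrow> real) \<Rightarrow> (nat \<Rightarrow> real) \<Rightarrow> (nat \<Rightarrow> real) \<Rightarrow> real vec" where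
  "weights q \<alpha> \<beta> d = row (butcher_matrix q \<alpha> \<beta> d) q"

(* For the finitely many z at which I - z A is singular the value is unspecified. *)
definition rk_stability :: "real mat \<Rightarrow> real vec \<Rightarrow> complex \<Rightarrow> complex" where
  "rk_stability A b z =
     1 + z * (map_vec complex_of_real b \<bullet>
       (the (mat_inverse (1\<^sub>m (dim_row A) - z \<cdot>\<^sub>m map_mat complex_of_real A))
          *\<^sub>v vec (dim_row A) (\<lambda>_. 1)))"

definition stability_function ::
    "nat \<Rightarrow> (nat \<Rightarrow> real) \<Rightarrow> (nat \<Rightarrow> real) \<Rightarrow> (nat \<Rightarrow> real) \<Rightarrow> complex \<Rightarrow> complex" where
  "stability_function q \<alpha> \<beta> d = rk_stability (butcher_matrix q \<alpha> \<beta> d) (weights q \<alpha> \<beta> d)"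

definition stability_denom :: "nat \<Rightarrow> (nat \<Rightarrow> real) \<Rightarrow> real poly" where
  "stability_denom q d = (\<Prod>j=1..q-1. [:1, - d j:])"

(* The polynomial R * Q; existence and uniqueness are shown below. *)
definition stability_numer ::
    "nat \<Rightarrow> (nat \<Rightarrow> real) \<Rightarrow> (nat \<Rightarrow> real) \<Rightarrow> (nat \<Rightarrow> real) \<Rightarrow> real poly" where
  "stability_numer q \<alpha> \<beta> d = (THE p. \<forall>z.
     poly (map_poly complex_of_real (stability_denom q d)) z \<noteq> 0 \<longrightarrow>
     stability_function q \<alpha> \<beta> d z * poly (map_poly complex_of_real (stability_denom q d)) z
       = poly (map_poly complex_of_real p) z)"

definition numer_coeff ::
    "nat \<Rightarrow> (nat \<Rightarrow> real) \<Rightarrow> (nat \<Rightarrow> real) \<Rightarrow> (nat \<Rightarrow> real) \<Rightarrow> nat \<Rightarrow> real" where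
  "numer_coeff q \<alpha> \<beta> d j = coeff (stability_numer q \<alpha> \<beta> d) j"

definition implicit_stages :: "real mat \<Rightarrow> nat" where
  "implicit_stages A = card {i. i < dim_row A \<and> A $$ (i, i) \<noteq> 0}"

lemma implicit_stages_butcher_matrix:
  "implicit_stages (butcher_matrix q \<alpha> \<beta> d) = card {j \<in> {1..q-1}. d j \<noteq> 0}"
  unfolding implicit_stages_def butcher_matrix_def
  by (rule arg_cong[where f = card]) (auto split: if_splits)

lemma poly_denom:
  "poly (map_poly complex_of_real (stability_denom q d)) z
     = (\<Prod>j=1..q-1. 1 - z * complex_of_real (d j))"
proof -
  interpret of_real_poly_hom: map_poly_comm_ring_hom complex_of_real
    by unfold_locales auto
  show ?thesis
    unfolding stability_denom_def
    by (simp add: of_real_poly_hom.hom_prod poly_prod of_real_hom.map_poly_pCons_hom)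
qed

(* numer_rec alpha beta d j is the numerator of the j-th internal stage of y' = z y over the
   common denominator (1 - z d_1) ... (1 - z d_j). *)
fun numer_rec where
  "numer_rec \<alpha> \<beta> d 0 = (1 :: real poly)"
| "numer_rec \<alpha> \<beta> d (Suc j) = [:1, (if j = 0 then 0 else \<beta> j):] * (\<Prod>i=1..j. [:1, - d i:])
     + [:0, \<alpha> (Suc j):] * numer_rec \<alpha> \<beta> d j"

lemma numer_rec_degree: "degree (numer_rec \<alpha> \<beta> d j) \<le> j"
proof (induction j)
  case (Suc j)
  have "degree (\<Prod>i=1..j. [:1, - d i:]) \<le> sum (degree \<circ> (\<lambda>i. [:1, - d i:])) {1..j}"
    by (rule degree_prod_sum_le) simp
  also have "\<dots> \<le> (\<Sum>i=1..j. 1)" by (rule sum_mono) auto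
  finally have D: "degree (\<Prod>i=1..j. [:1, - d i:]) \<le> j" by simp
  have "degree ([:1, (if j = 0 then 0 else \<beta> j):] * (\<Prod>i=1..j. [:1, - d i:])) \<le> Suc j"
    by (rule order_trans[OF degree_mult_le]) (use D in auto)
  moreover have "degree ([:0, \<alpha> (Suc j):] * numer_rec \<alpha> \<beta> d j) \<le> Suc j"
    by (rule order_trans[OF degree_mult_le]) (use Suc.IH in auto)
  ultimately show ?case by (simp only: numer_rec.simps degree_add_le)
qed simp

lemma numer_rec_0: "coeff (numer_rec \<alpha> \<beta> d j) 0 = 1"
proof (cases j)
  case (Suc m)
  then show ?thesis by (simp add: poly_0_coeff_0[symmetric] poly_prod)
qed simp

lemma numer_rec_poly:
  "poly (map_poly complex_of_real (numer_rec \<alpha> \<beta> d (Suc j))) z =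
   (1 + z * complex_of_real (if j = 0 then 0 else \<beta> j)) * (\<Prod>i=1..j. 1 - z * complex_of_real (d i))
    + z * complex_of_real (\<alpha> (Suc j)) * poly (map_poly complex_of_real (numer_rec \<alpha> \<beta> d j)) z"
proof -
  interpret of_real_poly_hom: map_poly_comm_ring_hom complex_of_real
    by unfold_locales auto
  show ?thesis
    by (simp only: numer_rec.simps of_real_poly_hom.hom_prod of_real_poly_hom.hom_mult
        of_real_poly_hom.hom_add poly_prod poly_mult poly_add) (simp add: of_real_hom.map_poly_pCons_hom)
qed

lemma stability_function_times_denom:
  assumes q: "q \<ge> 2"
    and nz: "poly (map_poly complex_of_real (stability_denom q d)) z \<noteq> 0"
  shows "stability_function q \<alpha> \<beta> d z * poly (map_poly complex_of_real (stability_denom q d)) z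
    = poly (map_poly complex_of_real (numer_rec \<alpha> \<beta> (\<lambda>i. if i < q then d i else 0) q)) z"
proof -
  define A where "A = map_mat complex_of_real (butcher_matrix q \<alpha> \<beta> d)"
  define d' where "d' = (\<lambda>i. if i < q then d i else 0)"
  define M where "M = 1\<^sub>m (q + 1) - z \<cdot>\<^sub>m A"
  have A: "A \<in> carrier_mat (q + 1) (q + 1)" by (simp add: A_def butcher_matrix_def)
  have M: "M \<in> carrier_mat (q + 1) (q + 1)"
    unfolding M_def by (intro minus_carrier_mat smult_carrier_mat A)
  have Q: "poly (map_poly complex_of_real (stability_denom q d)) z
     = (\<Prod>j=1..q. 1 - z * complex_of_real (d' j))"
  proof -
    have "{1..q} = insert q {1..q-1}" using q by auto
    then show ?thesis using q by (auto simp: poly_denom d'_def intro!: prod.cong)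
  qed
  have "det M = (\<Prod>j<q+1. M $$ (j, j))"
  proof (subst det_lower_triangular[OF _ M])
    show "M $$ (i, j) = 0" if "i < j" "j < q + 1" for i j
      using that by (simp add: M_def A_def butcher_matrix_def)
    show "prod_list (diag_mat M) = (\<Prod>j<q+1. M $$ (j, j))"
      using M by (simp add: prod_list_diag_prod lessThan_atLeast0)
  qed
  also have "\<dots> = (\<Prod>j<q+1. 1 - z * complex_of_real (if j = 0 then 0 else d' j))"
    using q by (intro prod.cong) (auto simp: M_def A_def butcher_matrix_def d'_def)
  also have "{..<q+1} = insert 0 {1..q}" by auto
  also have "(\<Prod>j\<in>\<dots>. 1 - z * complex_of_real (if j = 0 then 0 else d' j))
      = (\<Prod>j=1..q. 1 - z * complex_of_real (d' j))"
    by (auto intro!: prod.cong)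
  finally have "det M \<noteq> 0" using nz Q by simp
  then have "M \<in> Units (ring_mat TYPE(complex) (q + 1) ())"
    by (rule det_non_zero_imp_unit[OF M])
  then obtain B where inv: "mat_inverse M = Some B"
    using mat_inverse(1)[OF M, of "()"] by (cases "mat_inverse M") auto
  have B: "M * B = 1\<^sub>m (q + 1)" "B \<in> carrier_mat (q + 1) (q + 1)"
    using mat_inverse(2)[OF M inv] by auto
  define one where "one = vec (q + 1) (\<lambda>_. 1 :: complex)"
  define v where "v = B *\<^sub>v one"
  have one: "one \<in> carrier_vec (q + 1)" by (simp add: one_def)
  have v: "v \<in> carrier_vec (q + 1)" using B one by (simp add: v_def)
  have Mv: "M *\<^sub>v v = one"
    using assoc_mult_mat_vec[OF M B(2) one] B one by (simp add: v_def)
  have row: "row A i \<bullet> v =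
      (if i = 0 then 0 else complex_of_real (\<alpha> i) * v $ (i - 1))
       + (if 2 \<le> i then complex_of_real (\<beta> (i - 1)) * v $ 0 else 0)
       + (if i = 0 then 0 else complex_of_real (d' i) * v $ i)" if "i < q + 1" for i
  proof -
    have "row A i \<bullet> v = (\<Sum>j<q+1. A $$ (i, j) * v $ j)"
      using that A v by (simp add: scalar_prod_def lessThan_atLeast0)
    also have "\<dots> = (\<Sum>j<q+1.
        (if j = i - 1 then if i = 0 then 0 else complex_of_real (\<alpha> i) * v $ j else 0)
       + (if j = 0 then if 2 \<le> i then complex_of_real (\<beta> (i - 1)) * v $ j else 0 else 0)
       + (if j = i then if i = 0 then 0 else complex_of_real (d' i) * v $ j else 0))"
      using that by (intro sum.cong) (auto simp: A_def butcher_matrix_def d'_def)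
    also have "\<dots> = (if i = 0 then 0 else complex_of_real (\<alpha> i) * v $ (i - 1))
       + (if 2 \<le> i then complex_of_real (\<beta> (i - 1)) * v $ 0 else 0)
       + (if i = 0 then 0 else complex_of_real (d' i) * v $ i)"
      using that unfolding sum.distrib by (simp only: sum.delta finite_lessThan) auto
    finally show ?thesis .
  qed
  have stage: "v $ i = 1 + z * (row A i \<bullet> v)" if "i < q + 1" for i
  proof -
    have "1 = (M *\<^sub>v v) $ i" using that by (simp add: Mv one_def)
    also have "\<dots> = row M i \<bullet> v" using that M by simp
    also have "row M i = row (1\<^sub>m (q + 1)) i - z \<cdot>\<^sub>v row A i"
      using that A by (intro eq_vecI) (auto simp: M_def)
    also have "\<dots> \<bullet> v = row (1\<^sub>m (q + 1)) i \<bullet> v - (z \<cdot>\<^sub>v row A i) \<bullet> v"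
      using that A v by (intro minus_scalar_prod_distrib) auto
    also have "row (1\<^sub>m (q + 1)) i \<bullet> v = v $ i" using that v by simp
    also have "(z \<cdot>\<^sub>v row A i) \<bullet> v = z * (row A i \<bullet> v)" using that A v by simp
    finally show ?thesis by (simp add: diff_eq_eq)
  qed
  have v0: "v $ 0 = 1" using stage[of 0] row[of 0] by simp
  have main: "v $ j * (\<Prod>i=1..j. 1 - z * complex_of_real (d' i))
      = poly (map_poly complex_of_real (numer_rec \<alpha> \<beta> d' j)) z" if "j \<le> q" for j
    using that
  proof (induction j)
    case (Suc j)
    define D where "D = (\<Prod>i=1..j. 1 - z * complex_of_real (d' i))"
    have step: "v $ Suc j * (1 - z * complex_of_real (d' (Suc j)))
       = 1 + z * complex_of_real (if j = 0 then 0 else \<beta> j) + z * complex_of_real (\<alpha> (Suc j)) * v $ j"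
      using stage[of "Suc j"] row[of "Suc j"] Suc.prems v0 by (auto simp: algebra_simps)
    have "v $ Suc j * (D * (1 - z * complex_of_real (d' (Suc j))))
       = v $ Suc j * (1 - z * complex_of_real (d' (Suc j))) * D"
      by (simp only: mult_ac)
    also have "\<dots> = (1 + z * complex_of_real (if j = 0 then 0 else \<beta> j)) * D
         + z * complex_of_real (\<alpha> (Suc j)) * (v $ j * D)"
      unfolding step by (simp only: distrib_right mult.assoc)
    finally show ?case using Suc unfolding numer_rec_poly by (simp add: D_def mult_ac)
  qed (simp add: v0)
  have "stability_function q \<alpha> \<beta> d z = v $ q"
  proof -
    have "map_vec complex_of_real (weights q \<alpha> \<beta> d) = row A q"
      by (intro eq_vecI) (auto simp: weights_def A_def butcher_matrix_def)
    moreover have "dim_row (butcher_matrix q \<alpha> \<beta> d) = q + 1"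
      by (simp add: butcher_matrix_def)
    ultimately show ?thesis
      using stage[of q] inv
      by (simp add: stability_function_def rk_stability_def M_def A_def v_def one_def)
  qed
  then show ?thesis using main[of q] Q by (simp add: d'_def)
qed

lemma stability_numer_unique:
  assumes q: "q \<ge> 2"
    and p: "\<And>z. poly (map_poly complex_of_real (stability_denom q d)) z \<noteq> 0 \<Longrightarrow>
     stability_function q \<alpha> \<beta> d z * poly (map_poly complex_of_real (stability_denom q d)) z
       = poly (map_poly complex_of_real p) z"
  shows "stability_numer q \<alpha> \<beta> d = p"
proof -
  interpret of_real_poly_hom: map_poly_inj_idom_hom complex_of_real
    by unfold_locales auto
  let ?Q = "map_poly complex_of_real (stability_denom q d)"
  have "p' = p" if p': "\<forall>z. poly ?Q z \<noteq> 0 \<longrightarrow>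
     stability_function q \<alpha> \<beta> d z * poly ?Q z = poly (map_poly complex_of_real p') z" for p'
  proof -
    have "stability_denom q d \<noteq> 0" by (simp add: stability_denom_def)
    then have "?Q \<noteq> 0" by simp
    moreover have "poly ((map_poly complex_of_real p' - map_poly complex_of_real p) * ?Q) z = 0" for z
      using p[of z] p' by (cases "poly ?Q z = 0") auto
    ultimately have "map_poly complex_of_real p' - map_poly complex_of_real p = 0"
      by (metis mult_eq_0_iff poly_all_0_iff_0)
    then show ?thesis by simp
  qed
  then show ?thesis unfolding stability_numer_def by (intro the_equality) (use p in blast)+
qed

lemma stability_numer_properties:
  assumes q: "q \<ge> 2"
  shows "poly (map_poly complex_of_real (stability_denom q d)) z \<noteq> 0 \<Longrightarrow>
     stability_function q \<alpha> \<beta> d z =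
       poly (map_poly complex_of_real (stability_numer q \<alpha> \<beta> d)) z
       / poly (map_poly complex_of_real (stability_denom q d)) z"
    and "degree (stability_numer q \<alpha> \<beta> d) \<le> q"
    and "coeff (stability_numer q \<alpha> \<beta> d) 0 = 1"
proof -
  have eq: "stability_numer q \<alpha> \<beta> d = numer_rec \<alpha> \<beta> (\<lambda>i. if i < q then d i else 0) q"
    by (rule stability_numer_unique[OF q]) (rule stability_function_times_denom[OF q])
  show "degree (stability_numer q \<alpha> \<beta> d) \<le> q" "coeff (stability_numer q \<alpha> \<beta> d) 0 = 1"
    unfolding eq by (simp_all add: numer_rec_degree numer_rec_0)
  show "stability_function q \<alpha> \<beta> d z =
       poly (map_poly complex_of_real (stability_numer q \<alpha> \<beta> d)) z
       / poly (map_poly complex_of_real (stability_denom q d)) z"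
    if "poly (map_poly complex_of_real (stability_denom q d)) z \<noteq> 0"
    using stability_function_times_denom[OF q that, of \<alpha> \<beta>] that
    unfolding eq by (simp add: field_simps)
qed

end

theory Submission
  imports Defs "HOL-Analysis.Elementary_Normed_Spaces"
begin

text \<open>Outside the finitely many zeros of the denominator \<open>Q\<close>, the stability function is a quotient
  \<open>P / Q\<close> of polynomials, so its behaviour at infinity is a comparison of degrees: a quotient of
  nonzero polynomials tends to \<open>0\<close> exactly when the denominator has the larger degree
  (\<open>poly_divide_tendsto_0_iff\<close>). Each factor \<open>1 - z d\<^sub>j\<close> of \<open>Q\<close> contributes one to the degree if
  \<open>d\<^sub>j \<noteq> 0\<close> and nothing otherwise, so \<open>degree Q\<close> counts the nontrivial implicit stages
  (\<open>degree_stability_denom\<close>). The vanishing of the coefficients from \<open>k\<close> to \<open>q\<close> says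
  \<open>degree P \<le> k - 1\<close>, which gives decay as soon as there are at least \<open>k\<close> implicit stages. For the
  converse the degree of \<open>P\<close> must be known exactly. It is \<open>k - 1\<close> if the coefficient of index
  \<open>k - 1\<close> is nonzero; for \<open>k = 1\<close> that coefficient is \<open>P(0) = 1\<close>.\<close>

text \<open>The normalisation by an arbitrary power \<open>n \<ge> degree p\<close>, rather than by the degree itself, lets
  two polynomials of different degrees be compared on the same scale.\<close>

lemma poly_divide_power_tendsto_coeff:
  fixes p :: "'a :: real_normed_field poly"
  assumes "degree p \<le> n"
  shows "((\<lambda>x. poly p x / x ^ n) \<longlongrightarrow> coeff p n) at_infinity"
proof (cases "degree p = n")
  case True
  then show ?thesis using poly_divide_tendsto_aux[of p] by simp
next
  case False
  with assms have less: "degree p < degree (monom (1 :: 'a) n)" by (simp add: degree_monom_eq)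
  then have "coeff p n = 0" by (simp add: degree_monom_eq coeff_eq_0)
  then show ?thesis using poly_divide_tendsto_0_at_infinity[OF less] by (simp add: poly_monom)
qed

lemma eventually_poly_nonzero_at_infinity:
  fixes p :: "'a :: real_normed_field poly"
  assumes "p \<noteq> 0"
  shows "\<forall>\<^sub>F x in at_infinity. poly p x \<noteq> 0"
proof -
  have "\<forall>\<^sub>F x in at_infinity. poly p x / x ^ degree p \<noteq> 0"
    by (rule tendsto_imp_eventually_ne[OF poly_divide_tendsto_aux]) (use assms in simp)
  then show ?thesis by eventually_elim auto
qed

text \<open>If \<open>n = degree p \<ge> degree q\<close>, then \<open>q(x) / x\<^sup>n\<close> has a finite limit, so decay of \<open>p / q\<close> would
  force \<open>p(x) / x\<^sup>n\<close> to tend to \<open>0\<close>, whereas its limit is the leading coefficient of \<open>p\<close>.\<close>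

lemma poly_divide_tendsto_0_iff:
  fixes p q :: "'a :: real_normed_field poly"
  assumes "p \<noteq> 0" and "q \<noteq> 0"
  shows "((\<lambda>x. poly p x / poly q x) \<longlongrightarrow> 0) at_infinity \<longleftrightarrow> degree p < degree q"
proof
  assume lim: "((\<lambda>x. poly p x / poly q x) \<longlongrightarrow> 0) at_infinity"
  show "degree p < degree q"
  proof (rule ccontr)
    assume "\<not> degree p < degree q"
    then have "degree q \<le> degree p" by simp
    from tendsto_mult[OF lim poly_divide_power_tendsto_coeff[OF this]]
    have "((\<lambda>x. poly p x / poly q x * (poly q x / x ^ degree p)) \<longlongrightarrow> 0) at_infinity"
      by simp
    moreover have "\<forall>\<^sub>F x in at_infinity.
        poly p x / poly q x * (poly q x / x ^ degree p) = poly p x / x ^ degree p"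
      using eventually_poly_nonzero_at_infinity[OF \<open>q \<noteq> 0\<close>] by eventually_elim simp
    ultimately have "((\<lambda>x. poly p x / x ^ degree p) \<longlongrightarrow> 0) at_infinity"
      by (rule Lim_transform_eventually)
    with poly_divide_tendsto_aux[of p] have "lead_coeff p = 0"
      by (intro tendsto_unique[OF trivial_limit_at_infinity])
    with \<open>p \<noteq> 0\<close> show False by simp
  qed
qed (rule poly_divide_tendsto_0_at_infinity)

lemma degree_stability_denom:
  "degree (stability_denom q d) = implicit_stages (butcher_matrix q \<alpha> \<beta> d)"
proof -
  have "degree (stability_denom q d) = (\<Sum>j=1..q-1. degree [:1, - d j:])"
    unfolding stability_denom_def by (rule degree_prod_eq_sum_degree) simp
  also have "\<dots> = (\<Sum>j=1..q-1. if d j \<noteq> 0 then 1 else 0)"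
    by (rule sum.cong) auto
  also have "\<dots> = card {j \<in> {1..q-1}. d j \<noteq> 0}"
    by (simp add: sum.If_cases Int_def)
  finally show ?thesis by (simp only: implicit_stages_butcher_matrix)
qed

text \<open>The zeros of the denominator lie in a bounded set, so near infinity the stability function
  may be replaced by the quotient of its numerator and denominator. The numerator is nonzero
  because its constant coefficient is \<open>1\<close>.\<close>

lemma stability_function_tendsto_0_iff:
  assumes "q \<ge> 2"
  shows "(stability_function q \<alpha> \<beta> d \<longlongrightarrow> 0) at_infinity \<longleftrightarrow>
    degree (stability_numer q \<alpha> \<beta> d) < implicit_stages (butcher_matrix q \<alpha> \<beta> d)"
proof -
  interpret of_real_poly_hom: map_poly_inj_idom_hom complex_of_real
    by unfold_locales auto
  let ?P = "map_poly complex_of_real (stability_numer q \<alpha> \<beta> d)"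
  let ?Q = "map_poly complex_of_real (stability_denom q d)"
  have P: "?P \<noteq> 0" using stability_numer_properties(3)[OF assms, of \<alpha> \<beta> d] by auto
  have Q: "?Q \<noteq> 0" by (simp add: stability_denom_def)
  have "\<forall>\<^sub>F z in at_infinity. stability_function q \<alpha> \<beta> d z = poly ?P z / poly ?Q z"
    using eventually_poly_nonzero_at_infinity[OF Q]
    by eventually_elim (rule stability_numer_properties(1)[OF assms])
  then have "(stability_function q \<alpha> \<beta> d \<longlongrightarrow> 0) at_infinity \<longleftrightarrow>
      ((\<lambda>z. poly ?P z / poly ?Q z) \<longlongrightarrow> 0) at_infinity"
    by (rule tendsto_cong)
  also have "\<dots> \<longleftrightarrow> degree ?P < degree ?Q"
    by (rule poly_divide_tendsto_0_iff[OF P Q])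
  finally show ?thesis by (simp add: degree_stability_denom[of q d \<alpha> \<beta>])
qed

theorem theorem3p2:
  fixes q k :: nat and \<alpha> \<beta> d :: "nat \<Rightarrow> real"
  assumes "q \<ge> 2"
    and "k \<in> {1..q}"
    and "\<forall>j\<in>{k..q}. numer_coeff q \<alpha> \<beta> d j = 0"
  shows "((2 \<le> k \<longrightarrow> numer_coeff q \<alpha> \<beta> d (k - 1) \<noteq> 0) \<longrightarrow>
            ((stability_function q \<alpha> \<beta> d \<longlongrightarrow> 0) at_infinity
               \<longleftrightarrow> k \<le> implicit_stages (butcher_matrix q \<alpha> \<beta> d)))
       \<and> (k \<le> implicit_stages (butcher_matrix q \<alpha> \<beta> d) \<longrightarrow>
            (stability_function q \<alpha> \<beta> d \<longlongrightarrow> 0) at_infinity)"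
proof -
  let ?P = "stability_numer q \<alpha> \<beta> d"
  have le: "degree ?P \<le> k - 1"
  proof (rule degree_le, intro allI impI)
    fix j assume "k - 1 < j"
    then show "coeff ?P j = 0"
      using assms(2,3) stability_numer_properties(2)[OF assms(1), of \<alpha> \<beta> d]
      by (cases "j \<le> q") (auto simp: numer_coeff_def coeff_eq_0)
  qed
  have eq: "degree ?P = k - 1" if "2 \<le> k \<longrightarrow> numer_coeff q \<alpha> \<beta> d (k - 1) \<noteq> 0"
  proof (cases "2 \<le> k")
    case True
    with that have "k - 1 \<le> degree ?P" by (intro le_degree) (simp add: numer_coeff_def)
    with le show ?thesis by simp
  next
    case False
    with le show ?thesis by simp
  qed
  show ?thesis
    unfolding stability_function_tendsto_0_iff[OF assms(1)]
    using le eq assms(2) by auto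
qed

end
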